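(* Let $\{f_n\}_{n\ge1}$ and $f$ be probability density functions on $\mathbb{R}^d$ such that $f_n\to f$ in Lebesgue measure and $H(f)$ is finite. If $f>0$ almost everywhere and there is a constant $C$ such that $\operatorname{ess\,sup} f_n/f\le C$ for all $n$, then $H(f_n)\to H(f)$.
   Context: A probability density function (pdf) on $\mathbb{R}^d$ is a measurable $f:\mathbb{R}^d\to[0,\infty)$ with $\int f\,dx=1$. The differential entropy is $H(f)=-\int_{\mathbb{R}^d} f\log f\,dx$, with natural logarithm and the convention $0\log0=0$. "$H(f)$ finite" means $f\log f\in L^1(\mathbb{R}^d)$. The essential supremum is with respect to Lebesgue measure. *)

theory Defs
  imports "HOL-Analysis.Analysis" "HOL-Probability.Essential_Supremum"
begin

definition pdf :: "(real ^ 'd \<Rightarrow> real) \<Rightarrow> bool" where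
  "pdf f \<longleftrightarrow> f \<in> borel_measurable lebesgue \<and> (\<forall>x. 0 \<le> f x) \<and> (\<integral>\<^sup>+ x. ennreal (f x) \<partial>lebesgue) = 1"

(* Since 0 * ln 0 = 0 in any case, the convention 0 log 0 = 0 is built in. *)
definition finite_entropy :: "(real ^ 'd \<Rightarrow> real) \<Rightarrow> bool" where
  "finite_entropy f \<longleftrightarrow> integrable lebesgue (\<lambda>x. f x * ln (f x))"

(* The Bochner integral of a non-integrable function is 0, so this value is meaningful
   only together with finite_entropy f. *)
definition diff_entropy :: "(real ^ 'd \<Rightarrow> real) \<Rightarrow> real" where
  "diff_entropy f = - (\<integral> x. f x * ln (f x) \<partial>lebesgue)"

(* The measure of the exceptional set is taken in ennreal, because the real-valued measure
   of a set of infinite measure is 0. *)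
definition conv_in_measure ::
    "'a measure \<Rightarrow> (nat \<Rightarrow> 'a \<Rightarrow> real) \<Rightarrow> ('a \<Rightarrow> real) \<Rightarrow> bool" where
  "conv_in_measure M fs f \<longleftrightarrow>
     (\<forall>\<epsilon>>0. (\<lambda>n. emeasure M {x \<in> space M. \<bar>fs n x - f x\<bar> > \<epsilon>}) \<longlonglongrightarrow> 0)"

end

theory Submission
  imports Defs
begin

text \<open>Let \<open>t = f\<^sub>n x / f x \<in> [0, C]\<close>. Since \<open>f\<^sub>n ln f\<^sub>n = f (t ln t) + t (f ln f)\<close> and
  \<open>\<bar>t ln t\<bar> \<le> 1 + C\<^sup>2\<close>, the integrable function \<open>(1 + C\<^sup>2) f + C \<bar>f ln f\<bar>\<close> dominates all
  \<open>f\<^sub>n ln f\<^sub>n\<close>. Along a suitable subsequence of any given subsequence, \<open>f\<^sub>n \<longlonglongrightarrow> f\<close> almost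
  everywhere, and dominated convergence applies.\<close>

text \<open>If convergence fails, some open neighbourhood of \<open>L\<close> is missed at
  infinitely many indices. Enumerating these gives a subsequence that stays outside it, as does
  every further subsequence.\<close>

lemma tendsto_if_subseq_has_tendsto_subseq:
  fixes X :: "nat \<Rightarrow> 'a::topological_space"
  assumes "\<And>r :: nat \<Rightarrow> nat. strict_mono r \<Longrightarrow> \<exists>s :: nat \<Rightarrow> nat. strict_mono s \<and> (\<lambda>n. X (r (s n))) \<longlonglongrightarrow> L"
  shows "X \<longlonglongrightarrow> L"
proof (rule ccontr)
  assume "\<not> X \<longlonglongrightarrow> L"
  then obtain S where S: "open S" "L \<in> S" "\<not> eventually (\<lambda>n. X n \<in> S) sequentially"
    unfolding tendsto_def by auto
  define A where "A = {n. X n \<notin> S}"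
  have "infinite A"
    using S(3) by (simp add: A_def not_eventually flip: cofinite_eq_sequentially INFM_iff_infinite)
  then have mono: "strict_mono (enumerate A)" and A: "\<And>n. X (enumerate A n) \<notin> S"
    using enumerate_in_set[of A] by (auto simp: strict_mono_enumerate A_def)
  obtain s where "(\<lambda>n. X (enumerate A (s n))) \<longlonglongrightarrow> L"
    using assms[OF mono] by blast
  then have "eventually (\<lambda>n. X (enumerate A (s n)) \<in> S) sequentially"
    using S(1,2) by (rule topological_tendstoD)
  then show False
    by (simp add: A)
qed

lemma conv_in_measure_subseq:
  assumes "conv_in_measure M u v" "strict_mono r"
  shows "conv_in_measure M (\<lambda>n. u (r n)) v"
  using assms LIMSEQ_subseq_LIMSEQ[OF _ assms(2)]
  unfolding conv_in_measure_def comp_def by blast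

text \<open>F. Riesz's argument: pick increasing indices at which the set where the error exceeds
  \<open>(1/2)^n\<close> has measure below \<open>(1/2)^n\<close>. These measures are summable, so
  by Borel-Cantelli almost every point eventually lies outside these sets.\<close>

lemma conv_in_measure_AE_subseq:
  assumes [measurable]: "\<And>n. u n \<in> borel_measurable M" "v \<in> borel_measurable M"
    and conv: "conv_in_measure M u v"
  shows "\<exists>r. strict_mono r \<and> (AE x in M. (\<lambda>n. u (r n) x) \<longlonglongrightarrow> v x)"
proof -
  define B where "B = (\<lambda>k n. {x \<in> space M. \<bar>u n x - v x\<bar> > (1/2::real)^k})"
  \<comment> \<open>The index is sought beyond an arbitrary \<open>m\<close> so that the dependent
    choice below yields a strictly increasing \<open>r\<close>.\<close>
  have small: "\<exists>n>m. emeasure M (B k n) < ennreal ((1/2)^k)" for k m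
  proof -
    have "(\<lambda>n. emeasure M (B k n)) \<longlonglongrightarrow> 0"
      using conv by (simp add: conv_in_measure_def B_def)
    then have "eventually (\<lambda>n. emeasure M (B k n) < ennreal ((1/2)^k)) sequentially"
      by (rule order_tendstoD(2)) simp
    then have "eventually (\<lambda>n. n > m \<and> emeasure M (B k n) < ennreal ((1/2)^k)) sequentially"
      using eventually_gt_at_top[of m] by eventually_elim simp
    then show ?thesis
      by (auto dest: eventually_happens)
  qed
  have "\<exists>r. \<forall>n. emeasure M (B n (r n)) < ennreal ((1/2)^n) \<and> r n < r (Suc n)"
    using small by (intro dependent_nat_choice) blast+
  then obtain r where r: "\<And>n. emeasure M (B n (r n)) < ennreal ((1/2)^n)"
    and mono: "strict_mono r"
    by (auto simp: strict_mono_Suc_iff)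
  \<comment> \<open>Borel-Cantelli asks for summability of the real-valued measures, so the extended
    bound is transferred; the geometric series then dominates.\<close>
  have le: "measure M (B n (r n)) \<le> (1/2)^n" for n
    using r[of n] unfolding measure_def by (intro enn2real_leI) auto
  have "AE x in M. eventually (\<lambda>n. x \<in> space M - B n (r n)) sequentially"
  proof (rule borel_cantelli_AE1)
    show "B n (r n) \<in> sets M" for n
      unfolding B_def by measurable
    show "emeasure M (B n (r n)) < \<infinity>" for n
      using r[of n] by (rule less_trans) simp
    show "summable (\<lambda>n. measure M (B n (r n)))"
      by (rule summable_comparison_test'[of "\<lambda>n. (1/2::real)^n" 0]) (use le in auto)
  qed
  then have "AE x in M. (\<lambda>n. u (r n) x) \<longlonglongrightarrow> v x"
  proof eventually_elim
    fix x assume "eventually (\<lambda>n. x \<in> space M - B n (r n)) sequentially"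
    then have "eventually (\<lambda>n. norm (u (r n) x - v x) \<le> (1/2)^n) sequentially"
      by eventually_elim (auto simp: B_def)
    then have "(\<lambda>n. u (r n) x - v x) \<longlonglongrightarrow> 0"
      by (rule Lim_null_comparison) (simp add: LIMSEQ_power_zero)
    then show "(\<lambda>n. u (r n) x) \<longlonglongrightarrow> v x"
      by (simp add: LIM_zero_iff)
  qed
  with mono show ?thesis by blast
qed

text \<open>Continuity at almost every value of \<open>v\<close> is enough to carry an almost
  everywhere limit of a subsequence through \<open>\<phi>\<close>.\<close>

lemma dominated_convergence_in_measure:
  fixes \<phi> :: "real \<Rightarrow> real"
  assumes meas [measurable]: "\<And>n. u n \<in> borel_measurable M" "v \<in> borel_measurable M"
      "\<phi> \<in> borel_measurable borel"
    and conv: "conv_in_measure M u v"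
    and cont: "AE x in M. isCont \<phi> (v x)"
    and "integrable M w"
    and bound: "\<And>n. AE x in M. \<bar>\<phi> (u n x)\<bar> \<le> w x"
  shows "(\<lambda>n. \<integral>x. \<phi> (u n x) \<partial>M) \<longlonglongrightarrow> (\<integral>x. \<phi> (v x) \<partial>M)"
proof (rule tendsto_if_subseq_has_tendsto_subseq)
  fix r :: "nat \<Rightarrow> nat" assume "strict_mono r"
  then obtain s where "strict_mono s" and lim: "AE x in M. (\<lambda>n. u (r (s n)) x) \<longlonglongrightarrow> v x"
    using conv_in_measure_AE_subseq[OF meas(1,2) conv_in_measure_subseq[OF conv]] by blast
  have "(\<lambda>n. \<integral>x. \<phi> (u (r (s n)) x) \<partial>M) \<longlonglongrightarrow> (\<integral>x. \<phi> (v x) \<partial>M)"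
  proof (rule integral_dominated_convergence)
    show "AE x in M. (\<lambda>n. \<phi> (u (r (s n)) x)) \<longlonglongrightarrow> \<phi> (v x)"
      using lim cont by eventually_elim (rule isCont_tendsto_compose)
    show "AE x in M. norm (\<phi> (u (r (s n)) x)) \<le> w x" for n
      using bound[of "r (s n)"] by simp
  qed (use \<open>integrable M w\<close> in measurable)
  with \<open>strict_mono s\<close>
  show "\<exists>s. strict_mono s \<and> (\<lambda>n. \<integral>x. \<phi> (u (r (s n)) x) \<partial>M) \<longlonglongrightarrow> (\<integral>x. \<phi> (v x) \<partial>M)"
    by blast
qed

text \<open>The inequality \<open>ln s \<le> s - 1\<close> at \<open>s = t\<close> gives
  \<open>t * ln t \<le> t\<^sup>2 - t\<close>, and at \<open>s = 1 / t\<close> it gives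
  \<open>- (t * ln t) \<le> 1 - t\<close>.\<close>

lemma abs_mult_ln_le:
  fixes t :: real
  assumes "0 \<le> t"
  shows "\<bar>t * ln t\<bar> \<le> 1 + t\<^sup>2"
proof (cases "t = 0")
  case False
  with assms have t: "0 < t" by simp
  have "t * ln t \<le> t * (t - 1)"
    using t by (intro mult_left_mono ln_le_minus_one) auto
  moreover have "t * (- ln t) \<le> t * (1 / t - 1)"
    using t ln_le_minus_one[of "1 / t"] by (intro mult_left_mono) (auto simp: ln_div)
  ultimately show ?thesis
    using t by (intro abs_leI) (auto simp: algebra_simps power2_eq_square intro: order_trans[of _ 1])
qed simp

lemma abs_mult_ln_le_of_ratio_le:
  fixes a b C :: real
  assumes "0 \<le> a" "0 < b" "a / b \<le> C"
  shows "\<bar>a * ln a\<bar> \<le> (1 + C\<^sup>2) * b + C * \<bar>b * ln b\<bar>"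
proof -
  define t where "t = a / b"
  have t: "0 \<le> t" "t \<le> C" "a = t * b"
    using assms by (auto simp: t_def)
  have bound: "\<bar>t * ln t\<bar> \<le> 1 + C\<^sup>2"
    by (rule order_trans[OF abs_mult_ln_le[OF t(1)]])
      (intro add_left_mono power_mono[OF t(2,1)])
  \<comment> \<open>The splitting \<open>ln a = ln t + ln b\<close> requires \<open>t > 0\<close>;
    at \<open>t = 0\<close> all terms vanish.\<close>
  have "a * ln a = (t * ln t) * b + t * (b * ln b)"
    using t(1,3) assms(2) by (cases "t = 0") (auto simp: ln_mult algebra_simps)
  also have "\<bar>\<dots>\<bar> \<le> \<bar>t * ln t\<bar> * b + t * \<bar>b * ln b\<bar>"
    using t(1) assms(2) by (intro order_trans[OF abs_triangle_ineq]) (simp add: abs_mult)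
  also have "\<dots> \<le> (1 + C\<^sup>2) * b + C * \<bar>b * ln b\<bar>"
    using bound t(2) assms(2) by (intro add_mono mult_right_mono) auto
  finally show ?thesis .
qed

theorem corollary12:
  fixes fs :: "nat \<Rightarrow> real ^ 'd \<Rightarrow> real" and f :: "real ^ 'd \<Rightarrow> real" and C :: real
  assumes "\<And>n. pdf (fs n)" and "pdf f"
    and "conv_in_measure lebesgue fs f"
    and "finite_entropy f"
    and "AE x in lebesgue. f x > 0"
    and "\<And>n. esssup lebesgue (\<lambda>x. ereal (fs n x / f x)) \<le> ereal C"
  shows "(\<forall>n. finite_entropy (fs n)) \<and> (\<lambda>n. diff_entropy (fs n)) \<longlonglongrightarrow> diff_entropy f"
proof -
  have meas [measurable]: "fs n \<in> borel_measurable lebesgue" "f \<in> borel_measurable lebesgue" for n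
    using assms(1)[of n] assms(2) by (auto simp: pdf_def)
  define w where "w x = (1 + C\<^sup>2) * f x + C * \<bar>f x * ln (f x)\<bar>" for x
  have "integrable lebesgue f"
    using assms(2) by (intro integrableI_nonneg) (auto simp: pdf_def)
  then have w: "integrable lebesgue w"
    using assms(4) unfolding w_def finite_entropy_def by auto
  have bound: "AE x in lebesgue. \<bar>fs n x * ln (fs n x)\<bar> \<le> w x" for n
    \<comment> \<open>A function is almost everywhere at most its essential supremum, so the
      hypothesis becomes a pointwise bound off a null set. Where \<open>f x > 0\<close>, the
      quotient is a true ratio and not the default value of division by zero.\<close>
    using esssup_AE[of "\<lambda>x. ereal (fs n x / f x)" lebesgue] assms(5)
  proof eventually_elim
    case (elim x)
    then have "fs n x / f x \<le> C"
      using order_trans[OF _ assms(6)[of n]] by fastforce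
    moreover have "0 \<le> fs n x"
      using assms(1)[of n] by (simp add: pdf_def)
    ultimately show ?case
      unfolding w_def using elim(2) by (intro abs_mult_ln_le_of_ratio_le)
  qed
  \<comment> \<open>Domination by \<open>w\<close> makes each entropy a genuine integral, not the
    default 0 of a non-integrable function.\<close>
  have "finite_entropy (fs n)" for n
    unfolding finite_entropy_def
    by (rule Bochner_Integration.integrable_bound[OF w]) (use bound[of n] in auto)
  moreover have "(\<lambda>n. \<integral>x. fs n x * ln (fs n x) \<partial>lebesgue) \<longlonglongrightarrow> (\<integral>x. f x * ln (f x) \<partial>lebesgue)"
  proof (rule dominated_convergence_in_measure[where \<phi> = "\<lambda>y. y * ln y"])
    \<comment> \<open>Positivity of \<open>f\<close> keeps the limit values away from the
      discontinuity of \<open>ln\<close> at 0.\<close>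
    show "AE x in lebesgue. isCont (\<lambda>y. y * ln y) (f x)"
      using assms(5) by eventually_elim (intro isCont_mult continuous_ident isCont_ln; simp)
  qed (use assms(3) w bound in measurable)
  ultimately show ?thesis
    unfolding diff_entropy_def by (auto intro: tendsto_minus)
qed

end
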